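(* Every oriented graph $\vec{G}$ is $k$-mixing for every integer $k\ge \lceil \delta^*_{\rm avg}(\vec{G})\rceil+1$.
   Context: An oriented graph is a digraph with no pair of opposite arcs $uv,vu$. A $k$-dicolouring of a digraph is a map $V\to\{1,\dots,k\}$ with no monochromatic directed cycle; the $k$-dicolouring graph has these as vertices, adjacent when they differ on exactly one vertex; the digraph is $k$-mixing if this graph is connected. The average-degeneracy $\delta^*_{\rm avg}(D)$ is the smallest (possibly half-integral) $k$ such that every subdigraph $H$ of $D$ has a vertex $v$ with $\frac12(d^+_H(v)+d^-_H(v))\le k$. *)

theory Defs
  imports Complex_Main "Graph_Theory.Digraph_Component"
begin

locale oriented_graph = digraph G for G :: "('a, 'b) pre_digraph" (structure) +
  assumes no_opposite_arcs: "u \<rightarrow>\<^bsub>G\<^esub> v \<Longrightarrow> \<not> v \<rightarrow>\<^bsub>G\<^esub> u"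

(* The vertices of a cycle, given as a list of arcs, are the tails of its arcs.
   Cycles of length two (pairs of opposite arcs) count as directed cycles.
   Colourings are extensional, so that each map from the vertex set to {1..k}
   is represented by exactly one HOL function. *)
definition dicolouring :: "('a, 'b) pre_digraph \<Rightarrow> nat \<Rightarrow> ('a \<Rightarrow> nat) \<Rightarrow> bool" where
  "dicolouring D k \<phi> \<longleftrightarrow>
     \<phi> \<in> verts D \<rightarrow>\<^sub>E {1..k} \<and>
     \<not> (\<exists>p c. pre_digraph.cycle D p \<and> (\<forall>e \<in> set p. \<phi> (tail D e) = c))"

(* An undirected graph is represented by a symmetric digraph. *)
definition dicolouring_graph :: "('a, 'b) pre_digraph \<Rightarrow> nat \<Rightarrow> ('a \<Rightarrow> nat) pair_pre_digraph" where
  "dicolouring_graph D k =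
     \<lparr> pverts = {\<phi>. dicolouring D k \<phi>},
       parcs = {(\<phi>, \<psi>). dicolouring D k \<phi> \<and> dicolouring D k \<psi> \<and>
                 card {v \<in> verts D. \<phi> v \<noteq> \<psi> v} = 1} \<rparr>"

(* The qualifier distinguishes graph connectivity, which includes having at
   least one vertex, from topological connectedness. *)
definition mixing :: "nat \<Rightarrow> ('a, 'b) pre_digraph \<Rightarrow> bool" where
  "mixing k D \<longleftrightarrow> Digraph_Component.connected (with_proj (dicolouring_graph D k))"

(* Subdigraphs without vertices are excluded. Half-integrality is expressed by
   2 * k being a natural number, so the null digraph has average-degeneracy 0;
   for any other digraph the nonnegativity of k is implied. *)
definition avg_degeneracy :: "('a, 'b) pre_digraph \<Rightarrow> real" where
  "avg_degeneracy D =
     (LEAST k. 2 * k \<in> \<nat> \<and>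
        (\<forall>H. subgraph H D \<and> verts H \<noteq> {} \<longrightarrow>
           (\<exists>v \<in> verts H. (real (out_degree H v) + real (in_degree H v)) / 2 \<le> k)))"

end

theory Submission
  imports Defs
begin

text \<open>
  Remove a vertex \<open>v\<close> of total degree at most \<open>2(k-1)\<close> and lift a recolouring
  sequence of the rest. The only obstruction is a step that recolours some \<open>x\<close> with the current
  colour \<open>a\<close> of \<open>v\<close>, closing an \<open>a\<close>-coloured cycle through \<open>v\<close>. Since \<open>x\<close> is not both an
  in- and an out-neighbour of \<open>v\<close>, some neighbour of \<open>v\<close> has colour \<open>a\<close> already before
  the step. If every other colour occurred among both the in- and the out-neighbours of \<open>v\<close>, the
  degree of \<open>v\<close> would be at least \<open>2(k-1) + 1\<close>; so \<open>v\<close> can first be moved to another colour.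
\<close>

section \<open>Directed cycles and dicolourings in induced subdigraphs\<close>

text \<open>The vertex list of a walk is its start followed by the heads, or the tails followed by
  its end; on a closed walk start and end coincide. Colours are tested at tails only, so this gives
  control of the heads as well.\<close>

lemma (in wf_digraph) cycle_heads_eq_tails:
  assumes "cycle p"
  shows "head G ` set p = tail G ` set p"
proof -
  obtain u where u: "awalk u p u" and ne: "p \<noteq> []"
    using assms by (auto simp: cycle_def)
  have "awlast u p = u" and "awhd u p = u"
    using u by auto
  with ne have "head G (last p) = u" "tail G (hd p) = u"
    by (simp_all add: awalk_verts_conv hd_append hd_map)
  moreover have "set (awalk_verts u p) = insert u (head G ` set p)"
    using ne awalk_verts_conv'[of u p] calculation u by (auto simp: awalk_def)
  moreover have "set (awalk_verts u p) = insert u (tail G ` set p)"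
    using ne calculation by (auto simp: awalk_verts_conv)
  moreover have "u \<in> head G ` set p" "u \<in> tail G ` set p"
    using calculation(1,2) ne by (metis imageI last_in_set, metis imageI hd_in_set)
  ultimately show ?thesis
    by (simp add: insert_absorb)
qed

text \<open>Tails in \<open>S\<close> force heads in \<open>S\<close>, so every arc of the cycle
  survives in the induced subdigraph. This allows all later arguments to speak of cycles of
  \<open>G\<close> alone.\<close>

lemma (in wf_digraph) cycle_induce_subgraph_iff:
  assumes "S \<subseteq> verts G"
  shows "pre_digraph.cycle (G \<restriction> S) p \<longleftrightarrow> cycle p \<and> tail G ` set p \<subseteq> S"
proof
  assume "pre_digraph.cycle (G \<restriction> S) p"
  moreover have "subgraph (G \<restriction> S) G"
    using assms by (simp add: induced_induce induced_imp_subgraph)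
  ultimately have "cycle p"
    by (blast intro: subgraph_cycle)
  moreover have "tail G ` set p \<subseteq> S"
    using \<open>pre_digraph.cycle (G \<restriction> S) p\<close>
    by (auto simp: pre_digraph.cycle_def pre_digraph.awalk_def)
  ultimately show "cycle p \<and> tail G ` set p \<subseteq> S" ..
next
  assume *: "cycle p \<and> tail G ` set p \<subseteq> S"
  then obtain u where u: "awalk u p u" "distinct (tl (awalk_verts u p))" "p \<noteq> []"
    by (auto simp: cycle_def)
  have "u \<in> tail G ` set p"
    using u by (cases p) (auto simp: awalk_def)
  moreover have "head G ` set p \<subseteq> S"
    using * cycle_heads_eq_tails by simp
  ultimately have "pre_digraph.awalk (G \<restriction> S) u p u"
    using * u(1)
    by (auto simp: pre_digraph.awalk_def compatible_cas[OF compatible_induce_subgraph])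
  then show "pre_digraph.cycle (G \<restriction> S) p"
    unfolding pre_digraph.cycle_def
    using u compatible_awalk_verts[OF compatible_induce_subgraph, of G S] by metis
qed

lemma (in wf_digraph) dicolouring_induce_subgraph_iff:
  assumes "S \<subseteq> verts G"
  shows "dicolouring (G \<restriction> S) k \<phi> \<longleftrightarrow> \<phi> \<in> S \<rightarrow>\<^sub>E {1..k} \<and>
    (\<forall>p c. cycle p \<longrightarrow> tail G ` set p \<subseteq> S \<longrightarrow> (\<exists>e\<in>set p. \<phi> (tail G e) \<noteq> c))"
  using assms by (auto simp: dicolouring_def cycle_induce_subgraph_iff)

lemma (in wf_digraph) dicolouring_restrict:
  assumes "dicolouring (G \<restriction> S) k \<phi>" "T \<subseteq> S" "S \<subseteq> verts G"
  shows "dicolouring (G \<restriction> T) k (restrict \<phi> T)"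
proof -
  have "restrict \<phi> T \<in> T \<rightarrow>\<^sub>E {1..k}"
    using assms by (auto simp: dicolouring_induce_subgraph_iff)
  moreover have "\<exists>e\<in>set p. restrict \<phi> T (tail G e) \<noteq> c"
    if p: "cycle p" "tail G ` set p \<subseteq> T" for p c
  proof -
    have "\<exists>e\<in>set p. \<phi> (tail G e) \<noteq> c"
      using assms p by (auto simp: dicolouring_induce_subgraph_iff)
    then show ?thesis
      using p(2) by auto
  qed
  ultimately show ?thesis
    using assms by (simp add: dicolouring_induce_subgraph_iff)
qed

section \<open>Extending a dicolouring by one vertex\<close>

text \<open>A cycle missing \<open>v\<close> lies in \<open>S\<close>, where the restriction already
  excludes it; only cycles through \<open>v\<close> remain to be checked.\<close>

lemma (in wf_digraph) dicolouring_insertI: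
  assumes "insert v S \<subseteq> verts G" "v \<notin> S"
    and rest: "dicolouring (G \<restriction> S) k (restrict \<psi> S)"
    and range: "\<psi> \<in> insert v S \<rightarrow>\<^sub>E {1..k}"
    and avoid: "\<And>p. cycle p \<Longrightarrow> tail G ` set p \<subseteq> insert v S \<Longrightarrow> v \<in> tail G ` set p \<Longrightarrow>
      \<forall>e\<in>set p. \<psi> (tail G e) = \<psi> v \<Longrightarrow> False"
  shows "dicolouring (G \<restriction> insert v S) k \<psi>"
proof -
  have "\<exists>e\<in>set p. \<psi> (tail G e) \<noteq> c"
    if p: "cycle p" "tail G ` set p \<subseteq> insert v S" for p c
  proof (cases "v \<in> tail G ` set p")
    case True
    then show ?thesis
      using avoid[OF p True] by force
  next
    case False
    then have "tail G ` set p \<subseteq> S"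
      using p(2) by blast
    moreover from this have "\<exists>e\<in>set p. restrict \<psi> S (tail G e) \<noteq> c"
      using rest p assms(1) by (simp add: dicolouring_induce_subgraph_iff)
    ultimately show ?thesis
      by (metis image_subset_iff restrict_apply')
  qed
  then show ?thesis
    using range assms(1) by (simp add: dicolouring_induce_subgraph_iff)
qed

text \<open>A \<open>b\<close>-coloured cycle through \<open>v\<close> leaves and enters
  \<open>v\<close> by arcs whose other ends, in the absence of loops, are neighbours of colour
  \<open>b\<close>. The value of \<open>\<phi>\<close> at \<open>v\<close> is arbitrary, so the
  lemma serves both to colour a new vertex and to recolour \<open>v\<close>.\<close>

lemma (in loopfree_digraph) dicolouring_fun_upd_if_not_blocked:
  assumes S: "insert v S \<subseteq> verts G" "v \<notin> S"
    and \<phi>: "dicolouring (G \<restriction> S) k (restrict \<phi> S)" "\<phi> \<in> extensional (insert v S)"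
    and b: "b \<in> {1..k}"
    and free: "\<not> (b \<in> \<phi> ` head G ` out_arcs (G \<restriction> insert v S) v \<and>
      b \<in> \<phi> ` tail G ` in_arcs (G \<restriction> insert v S) v)"
  shows "dicolouring (G \<restriction> insert v S) k (\<phi>(v := b))"
proof (rule dicolouring_insertI[OF S])
  have "restrict (\<phi>(v := b)) S = restrict \<phi> S"
    using S(2) by (auto simp: fun_eq_iff)
  then show "dicolouring (G \<restriction> S) k (restrict (\<phi>(v := b)) S)"
    using \<phi>(1) by simp
  have "restrict \<phi> S \<in> S \<rightarrow>\<^sub>E {1..k}"
    using \<phi>(1) S by (simp add: dicolouring_induce_subgraph_iff)
  then show "\<phi>(v := b) \<in> insert v S \<rightarrow>\<^sub>E {1..k}"
    using \<phi>(2) b by (auto simp: PiE_iff extensional_def)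
next
  fix p
  assume p: "cycle p" "tail G ` set p \<subseteq> insert v S" "v \<in> tail G ` set p"
    and "\<forall>e\<in>set p. (\<phi>(v := b)) (tail G e) = (\<phi>(v := b)) v"
  then have mono: "\<forall>e\<in>set p. (\<phi>(v := b)) (tail G e) = b"
    by simp
  have heads: "head G ` set p = tail G ` set p" and sub: "set p \<subseteq> arcs G"
    using p(1) by (simp_all add: cycle_heads_eq_tails) (auto simp: cycle_def)
  then have arcs: "set p \<subseteq> arcs (G \<restriction> insert v S)"
    using p(2) by auto
  obtain e f where e: "e \<in> set p" "tail G e = v" and f: "f \<in> set p" "head G f = v"
    using p(3) heads by (metis imageE)
  have "head G e \<noteq> v" "tail G f \<noteq> v"
    using e f sub no_loops by (metis subsetD)+
  moreover have "(\<phi>(v := b)) (head G e) = b"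
    using e(1) heads mono by (metis image_iff)
  moreover have "(\<phi>(v := b)) (tail G f) = b"
    using f(1) mono by blast
  ultimately have "\<phi> (head G e) = b" "\<phi> (tail G f) = b"
    by simp_all
  moreover have "e \<in> out_arcs (G \<restriction> insert v S) v" "f \<in> in_arcs (G \<restriction> insert v S) v"
    using e f arcs by (auto simp: out_arcs_def in_arcs_def)
  ultimately have "b \<in> \<phi> ` head G ` out_arcs (G \<restriction> insert v S) v"
      "b \<in> \<phi> ` tail G ` in_arcs (G \<restriction> insert v S) v"
    by (metis imageI)+
  then show False
    using free by blast
qed

text \<open>A monochromatic cycle through \<open>v\<close> under \<open>\<psi>\<close> stays inside
  the class of \<open>\<psi> v\<close>, so it would be monochromatic under \<open>\<phi>\<close>
  too. Only this one class has to be compared.\<close>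

lemma (in wf_digraph) dicolouring_insert_if_colour_class_subset:
  assumes "insert v S \<subseteq> verts G" "v \<notin> S"
    and "dicolouring (G \<restriction> S) k (restrict \<psi> S)" "\<psi> \<in> insert v S \<rightarrow>\<^sub>E {1..k}"
    and \<phi>: "dicolouring (G \<restriction> insert v S) k \<phi>"
    and classes: "\<And>u. u \<in> insert v S \<Longrightarrow> \<psi> u = \<psi> v \<Longrightarrow> \<phi> u = \<psi> v"
  shows "dicolouring (G \<restriction> insert v S) k \<psi>"
proof (rule dicolouring_insertI[OF assms(1-4)])
  fix p
  assume p: "cycle p" "tail G ` set p \<subseteq> insert v S"
    and mono: "\<forall>e\<in>set p. \<psi> (tail G e) = \<psi> v"
  then have "\<forall>e\<in>set p. \<phi> (tail G e) = \<psi> v"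
    using classes by blast
  then show False
    using \<phi> p assms(1) by (auto simp: dicolouring_induce_subgraph_iff)
qed

text \<open>Distinct colours seen along arcs at \<open>v\<close> need distinct arcs.\<close>

lemma (in fin_digraph) card_colours_le_degree:
  shows "A \<subseteq> \<phi> ` head G ` out_arcs (G \<restriction> S) v \<Longrightarrow> card A \<le> out_degree (G \<restriction> S) v"
    and "A \<subseteq> \<phi> ` tail G ` in_arcs (G \<restriction> S) v \<Longrightarrow> card A \<le> in_degree (G \<restriction> S) v"
proof -
  have "finite (out_arcs (G \<restriction> S) v)" "finite (in_arcs (G \<restriction> S) v)"
    by (simp_all add: out_arcs_def in_arcs_def)
  then show "A \<subseteq> \<phi> ` head G ` out_arcs (G \<restriction> S) v \<Longrightarrow> card A \<le> out_degree (G \<restriction> S) v"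
    and "A \<subseteq> \<phi> ` tail G ` in_arcs (G \<restriction> S) v \<Longrightarrow> card A \<le> in_degree (G \<restriction> S) v"
    using surj_card_le[of _ A "\<phi> \<circ> head G"] surj_card_le[of _ A "\<phi> \<circ> tail G"]
    by (auto simp: out_degree_def in_degree_def image_comp)
qed

text \<open>If no colour were available for \<open>v\<close>, all \<open>k\<close> colours would
  occur on both sides, giving total degree at least \<open>2 * k\<close>. Connectivity includes
  having a vertex, so existence has to be carried through the induction.\<close>

lemma (in digraph) ex_dicolouring_insert:
  assumes S: "insert v S \<subseteq> verts G" "v \<notin> S"
    and deg: "out_degree (G \<restriction> insert v S) v + in_degree (G \<restriction> insert v S) v + 2 \<le> 2 * k"
    and \<phi>: "dicolouring (G \<restriction> S) k \<phi>"
  shows "\<exists>\<psi>. dicolouring (G \<restriction> insert v S) k \<psi>"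
proof (rule ccontr)
  assume none: "\<nexists>\<psi>. dicolouring (G \<restriction> insert v S) k \<psi>"
  have "\<phi> \<in> S \<rightarrow>\<^sub>E {1..k}"
    using \<phi> S by (simp add: dicolouring_induce_subgraph_iff)
  then have "restrict \<phi> S = \<phi>" "\<phi> \<in> extensional (insert v S)"
    by (auto simp: PiE_iff extensional_def extensional_restrict)
  then have "{1..k} \<subseteq> \<phi> ` head G ` out_arcs (G \<restriction> insert v S) v"
      "{1..k} \<subseteq> \<phi> ` tail G ` in_arcs (G \<restriction> insert v S) v"
    using none dicolouring_fun_upd_if_not_blocked[OF S] \<phi> by (metis subsetI)+
  then have "k \<le> out_degree (G \<restriction> insert v S) v" "k \<le> in_degree (G \<restriction> insert v S) v"
    using card_colours_le_degree[of "{1..k}"] by (metis card_atLeastAtMost diff_Suc_1)+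
  then show False
    using deg by simp
qed

section \<open>Moves in the dicolouring graph\<close>

lemma pverts_dicolouring_graph:
  "pverts (dicolouring_graph D k) = {\<phi>. dicolouring D k \<phi>}"
  by (simp add: dicolouring_graph_def)

lemma wf_dicolouring_graph: "wf_digraph (with_proj (dicolouring_graph D k))"
  by unfold_locales (auto simp: dicolouring_graph_def)

text \<open>Reachability rather than adjacency, because the two colourings may also agree at
  \<open>x\<close> and then coincide.\<close>

lemma reachable_dicolouring_graph_if_agree:
  assumes "dicolouring D k \<phi>" "dicolouring D k \<psi>" "x \<in> verts D"
    and agree: "\<And>u. u \<in> verts D \<Longrightarrow> u \<noteq> x \<Longrightarrow> \<phi> u = \<psi> u"
  shows "\<phi> \<rightarrow>\<^sup>*\<^bsub>with_proj (dicolouring_graph D k)\<^esub> \<psi>"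
proof -
  interpret wf_digraph "with_proj (dicolouring_graph D k)"
    by (rule wf_dicolouring_graph)
  show ?thesis
  proof (cases "\<phi> x = \<psi> x")
    case True
    then have "\<phi> = \<psi>"
      using assms by (intro extensionalityI[of _ "verts D"])
        (auto simp: dicolouring_def PiE_iff)
    then show ?thesis
      using assms by (simp add: pverts_dicolouring_graph)
  next
    case False
    then have "{u \<in> verts D. \<phi> u \<noteq> \<psi> u} = {x}"
      using assms by auto
    then show ?thesis
      using assms by (intro reachable_adjI) (simp add: dicolouring_graph_def)
  qed
qed

section \<open>Lifting recolourings from \<open>S\<close> to \<open>insert v S\<close>\<close>

text \<open>At most two moves suffice: possibly one at \<open>v\<close>, then the given one. The
  colour of \<open>v\<close> under \<open>\<psi>\<close> is left open since \<open>v\<close> may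
  have to give way.\<close>

lemma (in oriented_graph) lift_recolouring_step:
  assumes S: "insert v S \<subseteq> verts G" "v \<notin> S"
    and deg: "out_degree (G \<restriction> insert v S) v + in_degree (G \<restriction> insert v S) v + 2 \<le> 2 * k"
    and \<phi>: "dicolouring (G \<restriction> insert v S) k \<phi>"
    and step: "restrict \<phi> S \<rightarrow>\<^bsub>with_proj (dicolouring_graph (G \<restriction> S) k)\<^esub> \<chi>"
  shows "\<exists>\<psi>. restrict \<psi> S = \<chi> \<and>
    \<phi> \<rightarrow>\<^sup>*\<^bsub>with_proj (dicolouring_graph (G \<restriction> insert v S) k)\<^esub> \<psi>"
proof -
  define c where "c = \<phi> v"
  interpret D: wf_digraph "with_proj (dicolouring_graph (G \<restriction> insert v S) k)"
    by (rule wf_dicolouring_graph)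
  have \<phi>_PiE: "\<phi> \<in> insert v S \<rightarrow>\<^sub>E {1..k}"
    using \<phi> S by (simp add: dicolouring_induce_subgraph_iff)
  have \<phi>_S: "dicolouring (G \<restriction> S) k (restrict \<phi> S)"
    and \<chi>: "dicolouring (G \<restriction> S) k \<chi>"
    and "card {u \<in> S. restrict \<phi> S u \<noteq> \<chi> u} = 1"
    using step by (auto simp: dicolouring_graph_def)
  then obtain x where diff: "{u \<in> S. restrict \<phi> S u \<noteq> \<chi> u} = {x}"
    by (metis card_1_singletonE)
  have x: "x \<in> S"
    using diff by blast
  have agree: "\<phi> u = \<chi> u" if "u \<in> S" "u \<noteq> x" for u
  proof -
    have "u \<notin> {u \<in> S. restrict \<phi> S u \<noteq> \<chi> u}"
      using diff that(2) by simp
    then show ?thesis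
      using that(1) by simp
  qed
  have \<chi>_PiE: "\<chi> \<in> S \<rightarrow>\<^sub>E {1..k}"
    using \<chi> S by (simp add: dicolouring_induce_subgraph_iff)
  then have \<chi>_ext: "restrict \<chi> S = \<chi>" "\<chi> \<in> extensional (insert v S)"
    by (auto simp: PiE_iff extensional_def extensional_restrict)
  have restrict_upd: "restrict (\<chi>(v := b)) S = \<chi>" for b
    using S(2) \<chi>_ext(1) by (metis restrict_fupd)
  have upd_PiE: "\<chi>(v := b) \<in> insert v S \<rightarrow>\<^sub>E {1..k}" if "b \<in> {1..k}" for b
    using \<chi>_PiE that by (auto simp: PiE_iff extensional_def)
  have c: "c \<in> {1..k}"
    using \<phi>_PiE by (auto simp: c_def)
  show ?thesis
  proof (cases "dicolouring (G \<restriction> insert v S) k (\<chi>(v := c))")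
    case True
    have "\<phi> \<rightarrow>\<^sup>*\<^bsub>with_proj (dicolouring_graph (G \<restriction> insert v S) k)\<^esub> \<chi>(v := c)"
      using agree x by (intro reachable_dicolouring_graph_if_agree[OF \<phi> True, of x]) (auto simp: c_def)
    then show ?thesis
      using restrict_upd by blast
  next
    case False
    \<comment> \<open>If \<open>x\<close> received another colour, the class of \<open>c\<close>
      would gain no vertex, and the step could be copied with \<open>v\<close> unchanged.\<close>
    have "\<chi> x = c"
    proof (rule ccontr)
      assume "\<chi> x \<noteq> c"
      have "\<phi> u = (\<chi>(v := c)) v" if "u \<in> insert v S" "(\<chi>(v := c)) u = (\<chi>(v := c)) v" for u
      proof (cases "u = v")
        case False
        then show ?thesis
          using that agree[of u] \<open>\<chi> x \<noteq> c\<close> by (cases "u = x") simp_all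
      qed (simp add: c_def)
      then have "dicolouring (G \<restriction> insert v S) k (\<chi>(v := c))"
        using \<chi> restrict_upd by (intro dicolouring_insert_if_colour_class_subset[OF S _ upd_PiE[OF c] \<phi>]) simp_all
      then show False
        using False by contradiction
    qed
    let ?out = "out_arcs (G \<restriction> insert v S) v"
    let ?in = "in_arcs (G \<restriction> insert v S) v"
    define Out where "Out = \<phi> ` head G ` ?out"
    define In where "In = \<phi> ` tail G ` ?in"
    have "c \<in> \<chi> ` head G ` ?out \<and> c \<in> \<chi> ` tail G ` ?in"
      using False dicolouring_fun_upd_if_not_blocked[OF S _ \<chi>_ext(2) c] \<chi> \<chi>_ext(1) by metis
    then obtain e f where e: "e \<in> ?out" "\<chi> (head G e) = c" and f: "f \<in> ?in" "\<chi> (tail G f) = c"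
      by (elim conjE imageE, intro that) simp_all
    have eG: "e \<in> arcs G" "tail G e = v" "head G e \<in> insert v S"
      and fG: "f \<in> arcs G" "head G f = v" "tail G f \<in> insert v S"
      using e(1) f(1) by (simp_all add: out_arcs_def in_arcs_def)
    have ends: "head G e \<in> S" "tail G f \<in> S"
      using eG fG no_loops by (metis insertE)+
    have "v \<rightarrow>\<^bsub>G\<^esub> head G e" "tail G f \<rightarrow>\<^bsub>G\<^esub> v"
      using eG(1,2) fG(1,2) in_arcs_imp_in_arcs_ends by metis+
    \<comment> \<open>Otherwise \<open>v\<close> and \<open>x\<close> would be joined by opposite
      arcs. A \<open>c\<close>-coloured neighbour other than \<open>x\<close> had colour
      \<open>c\<close> under \<open>\<phi>\<close> already.\<close>
    then have "head G e \<noteq> x \<or> tail G f \<noteq> x"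
      using no_opposite_arcs by metis
    then have c_nbr: "c \<in> Out \<or> c \<in> In"
      using agree[OF ends(1)] agree[OF ends(2)] e f unfolding Out_def In_def by (metis imageI)
    \<comment> \<open>Otherwise one side sees all \<open>k\<close> colours and the other at least
      \<open>k - 1\<close>: total degree at least \<open>2 * k - 1\<close>, one more than
      \<open>deg\<close> permits.\<close>
    have "\<exists>b\<in>{1..k} - {c}. \<not> (b \<in> Out \<and> b \<in> In)"
    proof (rule ccontr)
      assume "\<not> (\<exists>b\<in>{1..k} - {c}. \<not> (b \<in> Out \<and> b \<in> In))"
      then have blocked: "{1..k} - {c} \<subseteq> Out" "{1..k} - {c} \<subseteq> In"
        by blast+
      then have "{1..k} \<subseteq> Out \<or> {1..k} \<subseteq> In"
        using c_nbr by blast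
      then have "k \<le> out_degree (G \<restriction> insert v S) v \<or> k \<le> in_degree (G \<restriction> insert v S) v"
        unfolding Out_def In_def
        using card_colours_le_degree[of "{1..k}"] by (metis card_atLeastAtMost diff_Suc_1)
      moreover have "k - 1 \<le> out_degree (G \<restriction> insert v S) v" "k - 1 \<le> in_degree (G \<restriction> insert v S) v"
        using card_colours_le_degree(1)[OF blocked(1)[unfolded Out_def]]
          card_colours_le_degree(2)[OF blocked(2)[unfolded In_def]] c by simp_all
      ultimately show False
        using deg c by auto
    qed
    then obtain b where b: "b \<in> {1..k}" "b \<noteq> c"
      and free: "\<not> (b \<in> \<phi> ` head G ` ?out \<and> b \<in> \<phi> ` tail G ` ?in)"
      unfolding Out_def In_def by blast
    have upd: "dicolouring (G \<restriction> insert v S) k (\<phi>(v := b))"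
      using \<phi>_PiE \<phi>_S b(1) free by (intro dicolouring_fun_upd_if_not_blocked[OF S]) (auto simp: PiE_iff)
    \<comment> \<open>Since \<open>x\<close> moves to \<open>c\<close>, which is not
      \<open>b\<close>, its move adds nothing to the new colour class of \<open>v\<close>.\<close>
    have "(\<phi>(v := b)) u = (\<chi>(v := b)) v"
      if "u \<in> insert v S" "(\<chi>(v := b)) u = (\<chi>(v := b)) v" for u
    proof (cases "u = v")
      case False
      then show ?thesis
        using that agree[of u] \<open>\<chi> x = c\<close> b(2) by (cases "u = x") simp_all
    qed simp
    then have upd': "dicolouring (G \<restriction> insert v S) k (\<chi>(v := b))"
      using \<chi> restrict_upd
      by (intro dicolouring_insert_if_colour_class_subset[OF S _ upd_PiE[OF b(1)] upd]) simp_all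
    have "\<phi> \<rightarrow>\<^sup>*\<^bsub>with_proj (dicolouring_graph (G \<restriction> insert v S) k)\<^esub> \<phi>(v := b)"
      by (intro reachable_dicolouring_graph_if_agree[OF \<phi> upd, of v]) auto
    also have "\<phi>(v := b) \<rightarrow>\<^sup>*\<^bsub>with_proj (dicolouring_graph (G \<restriction> insert v S) k)\<^esub> \<chi>(v := b)"
      using agree x by (intro reachable_dicolouring_graph_if_agree[OF upd upd', of x]) auto
    finally show ?thesis
      using restrict_upd by blast
  qed
qed

lemma (in oriented_graph) lift_recolouring_sequence:
  assumes S: "insert v S \<subseteq> verts G" "v \<notin> S"
    and deg: "out_degree (G \<restriction> insert v S) v + in_degree (G \<restriction> insert v S) v + 2 \<le> 2 * k"
    and \<phi>: "dicolouring (G \<restriction> insert v S) k \<phi>"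
    and seq: "restrict \<phi> S \<rightarrow>\<^sup>*\<^bsub>with_proj (dicolouring_graph (G \<restriction> S) k)\<^esub> \<chi>"
  shows "\<exists>\<psi>. restrict \<psi> S = \<chi> \<and>
    \<phi> \<rightarrow>\<^sup>*\<^bsub>with_proj (dicolouring_graph (G \<restriction> insert v S) k)\<^esub> \<psi>"
proof -
  interpret D: wf_digraph "with_proj (dicolouring_graph (G \<restriction> insert v S) k)"
    by (rule wf_dicolouring_graph)
  interpret D': wf_digraph "with_proj (dicolouring_graph (G \<restriction> S) k)"
    by (rule wf_dicolouring_graph)
  show ?thesis
    using seq
  proof (induction rule: D'.reachable_induct)
    case base
    have "\<phi> \<rightarrow>\<^sup>*\<^bsub>with_proj (dicolouring_graph (G \<restriction> insert v S) k)\<^esub> \<phi>"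
      using \<phi> by (simp add: pverts_dicolouring_graph)
    then show ?case
      by blast
  next
    case (step \<chi> \<chi>')
    then obtain \<psi> where \<psi>: "restrict \<psi> S = \<chi>"
      "\<phi> \<rightarrow>\<^sup>*\<^bsub>with_proj (dicolouring_graph (G \<restriction> insert v S) k)\<^esub> \<psi>"
      by blast
    have \<psi>_col: "dicolouring (G \<restriction> insert v S) k \<psi>"
      using D.reachable_in_verts(2)[OF \<psi>(2)] by (simp add: pverts_dicolouring_graph)
    obtain \<psi>' where "restrict \<psi>' S = \<chi>'"
      "\<psi> \<rightarrow>\<^sup>*\<^bsub>with_proj (dicolouring_graph (G \<restriction> insert v S) k)\<^esub> \<psi>'"
      using lift_recolouring_step[OF S deg \<psi>_col, of \<chi>'] \<psi>(1) step.hyps(2) by blast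
    then show ?case
      using \<psi>(2) D.reachable_trans by blast
  qed
qed

section \<open>Connectivity by induction on the vertex set\<close>

text \<open>The degree bound ranges over all nonempty \<open>T\<close>, so it passes to smaller
  sets. To join \<open>\<alpha>\<close> to \<open>\<beta>\<close>, remove a low-degree
  \<open>v\<close>, recolour the restrictions by induction, lift from \<open>\<alpha>\<close>, and
  finally correct the colour of \<open>v\<close>.\<close>

lemma (in oriented_graph) strongly_connected_dicolouring_graph:
  assumes deg: "\<And>T. T \<subseteq> verts G \<Longrightarrow> T \<noteq> {} \<Longrightarrow>
      \<exists>v\<in>T. out_degree (G \<restriction> T) v + in_degree (G \<restriction> T) v + 2 \<le> 2 * k"
    and "S \<subseteq> verts G"
  shows "strongly_connected (with_proj (dicolouring_graph (G \<restriction> S) k))"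
proof -
  have "finite S"
    using assms(2) by (rule finite_subset) simp
  then show ?thesis
    using assms(2)
  proof (induction rule: finite_psubset_induct)
    case (psubset S)
    show ?case
    proof (cases "S = {}")
      case True
      \<comment> \<open>Extensionality leaves exactly one colouring of the empty set, so the base
        graph is a single vertex.\<close>
      have "dicolouring (G \<restriction> {}) k \<phi> \<longleftrightarrow> \<phi> = (\<lambda>_. undefined)" for \<phi>
        by (auto simp: dicolouring_induce_subgraph_iff cycle_def)
      then show ?thesis
        using True
        by (simp add: strongly_connected_def pverts_dicolouring_graph
            wf_digraph.reachable_refl[OF wf_dicolouring_graph])
    next
      case False
      then obtain v where v: "v \<in> S" "out_degree (G \<restriction> S) v + in_degree (G \<restriction> S) v + 2 \<le> 2 * k"
        using deg psubset.prems by blast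
      define T where "T = S - {v}"
      have S_eq: "S = insert v T"
        using v(1) by (auto simp: T_def)
      have T: "insert v T \<subseteq> verts G" "v \<notin> T"
        and deg_v: "out_degree (G \<restriction> insert v T) v + in_degree (G \<restriction> insert v T) v + 2 \<le> 2 * k"
        using psubset.prems v unfolding S_eq[symmetric] by (simp_all add: T_def)
      have "T \<subset> S" "T \<subseteq> verts G"
        using v(1) psubset.prems by (auto simp: T_def)
      then have IH: "strongly_connected (with_proj (dicolouring_graph (G \<restriction> T) k))"
        by (rule psubset.IH)
      interpret D: wf_digraph "with_proj (dicolouring_graph (G \<restriction> insert v T) k)"
        by (rule wf_dicolouring_graph)
      have "\<exists>\<phi>. dicolouring (G \<restriction> insert v T) k \<phi>"
        using IH ex_dicolouring_insert[OF T deg_v]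
        by (auto simp: strongly_connected_def dicolouring_graph_def)
      moreover have "\<alpha> \<rightarrow>\<^sup>*\<^bsub>with_proj (dicolouring_graph (G \<restriction> insert v T) k)\<^esub> \<beta>"
        if \<alpha>: "dicolouring (G \<restriction> insert v T) k \<alpha>" and \<beta>: "dicolouring (G \<restriction> insert v T) k \<beta>" for \<alpha> \<beta>
      proof -
        have "restrict \<alpha> T \<rightarrow>\<^sup>*\<^bsub>with_proj (dicolouring_graph (G \<restriction> T) k)\<^esub> restrict \<beta> T"
          using IH dicolouring_restrict[OF \<alpha> _ T(1)] dicolouring_restrict[OF \<beta> _ T(1)]
          by (auto simp: strongly_connected_def dicolouring_graph_def)
        then obtain \<psi> where \<psi>: "restrict \<psi> T = restrict \<beta> T"
          and "\<alpha> \<rightarrow>\<^sup>*\<^bsub>with_proj (dicolouring_graph (G \<restriction> insert v T) k)\<^esub> \<psi>"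
          using lift_recolouring_sequence[OF T deg_v \<alpha>] by blast
        note this(2)
        also have "\<psi> \<rightarrow>\<^sup>*\<^bsub>with_proj (dicolouring_graph (G \<restriction> insert v T) k)\<^esub> \<beta>"
        proof (rule reachable_dicolouring_graph_if_agree[OF _ \<beta>, of _ v])
          show "dicolouring (G \<restriction> insert v T) k \<psi>"
            using D.reachable_in_verts(2)[OF calculation] by (simp add: dicolouring_graph_def)
          show "\<psi> u = \<beta> u" if "u \<in> verts (G \<restriction> insert v T)" "u \<noteq> v" for u
            using that \<psi> by (auto dest: fun_cong[of _ _ u])
        qed simp
        finally show ?thesis .
      qed
      ultimately show ?thesis
        by (auto simp: S_eq strongly_connected_def dicolouring_graph_def)
    qed
  qed
qed

section \<open>The average-degeneracy is attained\<close>

text \<open>A \<open>LEAST\<close> over the reals has the defining property only if a minimum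
  exists. Half-integrality moves the question to the naturals, where any admissible value yields
  one.\<close>

lemma (in fin_digraph) ex_vertex_le_avg_degeneracy:
  assumes "subgraph H G" "verts H \<noteq> {}"
  shows "\<exists>v\<in>verts H. (real (out_degree H v) + real (in_degree H v)) / 2 \<le> avg_degeneracy G"
proof -
  define P where "P \<equiv> \<lambda>k::real. 2 * k \<in> \<nat> \<and> (\<forall>H. subgraph H G \<and> verts H \<noteq> {} \<longrightarrow>
    (\<exists>v\<in>verts H. (real (out_degree H v) + real (in_degree H v)) / 2 \<le> k))"
  \<comment> \<open>A crude admissible value: each in- and out-degree in a subdigraph is at most the
    number of arcs of \<open>G\<close>.\<close>
  have "P (real (card (arcs G)))"
  proof -
    have "(real (out_degree H v) + real (in_degree H v)) / 2 \<le> card (arcs G)"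
      if "subgraph H G" for H v
    proof -
      have "out_arcs H v \<subseteq> arcs G" "in_arcs H v \<subseteq> arcs G"
        using that by (auto simp: subgraph_def out_arcs_def in_arcs_def)
      then have "out_degree H v \<le> card (arcs G)" "in_degree H v \<le> card (arcs G)"
        by (simp_all add: out_degree_def in_degree_def card_mono)
      then show ?thesis
        by simp
    qed
    moreover have "2 * real n \<in> \<nat>" for n
      by (metis Nats_mult Nats_numeral of_nat_in_Nats)
    ultimately show ?thesis
      unfolding P_def by blast
  qed
  then have "\<exists>n. P (real n / 2)"
    by (metis P_def Nats_cases nonzero_mult_div_cancel_left zero_neq_numeral)
  then have least: "P (real (LEAST n. P (real n / 2)) / 2)"
    by (rule LeastI_ex)
  moreover have "real (LEAST n. P (real n / 2)) / 2 \<le> y" if "P y" for y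
  proof -
    obtain n where n: "2 * y = real n"
      using \<open>P y\<close> by (auto simp: P_def elim: Nats_cases)
    then have "y = real n / 2"
      by simp
    then have "(LEAST n. P (real n / 2)) \<le> n"
      using \<open>P y\<close> by (metis Least_le)
    then show ?thesis
      using n by simp
  qed
  ultimately have "P (LEAST k. P k)"
    by (rule LeastI2_order)
  then have "P (avg_degeneracy G)"
    by (simp add: P_def avg_degeneracy_def)
  then show ?thesis
    using assms by (simp add: P_def)
qed

theorem theorem7:
  fixes G :: "('a, 'b) pre_digraph" and k :: nat
  assumes "oriented_graph G"
    and "int k \<ge> \<lceil>avg_degeneracy G\<rceil> + 1"
  shows "mixing k G"
proof -
  interpret oriented_graph G
    by (rule assms(1))
  \<comment> \<open>Doubling this bounds the total degree of a suitable vertex by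
    \<open>2 * k - 2\<close>, which is the \<open>+ 2\<close> in the degree condition.\<close>
  have k: "avg_degeneracy G \<le> real k - 1"
    using assms(2) by linarith
  have "\<exists>v\<in>T. out_degree (G \<restriction> T) v + in_degree (G \<restriction> T) v + 2 \<le> 2 * k"
    if T: "T \<subseteq> verts G" "T \<noteq> {}" for T
  proof -
    have "subgraph (G \<restriction> T) G"
      using T by (simp add: induced_induce induced_imp_subgraph)
    then obtain v where v: "v \<in> T"
      and "(real (out_degree (G \<restriction> T) v) + real (in_degree (G \<restriction> T) v)) / 2 \<le> avg_degeneracy G"
      using ex_vertex_le_avg_degeneracy[of "G \<restriction> T"] T(2) by auto
    then have "real (out_degree (G \<restriction> T) v + in_degree (G \<restriction> T) v + 2) \<le> real (2 * k)"
      using k by simp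
    then show ?thesis
      using v of_nat_le_iff by blast
  qed
  then have "strongly_connected (with_proj (dicolouring_graph (G \<restriction> verts G) k))"
    by (rule strongly_connected_dicolouring_graph) simp_all
  moreover have "G \<restriction> verts G = G"
    by (rule pre_digraph.equality) auto
  ultimately have "strongly_connected (with_proj (dicolouring_graph G k))"
    by simp
  \<comment> \<open>\<open>connected\<close> means strong connectivity of the symmetric closure, to
    which reachability carries over.\<close>
  then show ?thesis
    unfolding mixing_def connected_def strongly_connected_def
    by (auto intro!: wf_digraph.reachable_mk_symmetricI[OF wf_dicolouring_graph])
qed

end
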